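(* Suppose that the following two conditions hold for every $(f,x,q,d,h)\in K_1\times K_2$: (1) $\dfrac{\partial A_s(d_s,h_s)}{\partial d_s}+\dfrac12\cdot\dfrac{\partial A_s(d_s,h_s)}{\partial h_s}+\dfrac12\cdot\dfrac{\partial B_s(d_s,h_s)}{\partial d_s}<0$ for all $s\in D$; (2) $\dfrac{\partial B_s(d_s,h_s)}{\partial h_s}+\dfrac12\cdot\dfrac{\partial B_s(d_s,h_s)}{\partial d_s}+\dfrac12\cdot\dfrac{\partial A_s(d_s,h_s)}{\partial h_s}<0$ for all $s\in D$. Then there is a unique $(f^*,x^*,q^*,d^*,h^* )\in K_1\times K_2$ solving the variational inequality $$\sum_{r\in O}\sum_{s\in D}\sum_{k\in R_{rs}}(f_k^{rs}-f_k^{rs*})\tfrac1\alpha\ln f_k^{rs*}+\sum_{a\in A}(x_a-x_a^* )t_a(x_a^* )+\sum_{r\in O}\sum_{s\in D}(q_{rs}-q_{rs}^* )\left(\tfrac1\gamma-\tfrac1\alpha\right)\ln q_{rs}^*-\sum_{s\in D}(d_s-d_s^* )A_s(d_s^*,h_s^* )+\sum_{s\in D}(h_s-h_s^* )\left[\tfrac1\beta\ln h_s^*-B_s(d_s^*,h_s^* )\right]\ge0$$ for all $(f,x,q,d,h)\in K_1\times K_2$.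
   Context: $G=(V,A)$ is a finite directed network with link set $A$, finite nonempty origin set $O$ and destination set $D$ (every destination is a business center). For $r\in O$, $s\in D$, $R_{rs}$ is the (finite, nonempty) set of simple routes from $r$ to $s$; $\delta_{ak}^{rs}=1$ if link $a$ lies on route $k\in R_{rs}$ and $0$ otherwise. $O_r>0$ is the fixed travel demand from origin $r$, and $T>0$ is the fixed total number of business companies. Variables: path flows $f=(f_k^{rs})$, link flows $x=(x_a)$, origin-destination demands $q=(q_{rs})$, destination demands $d=(d_s)$, business flows $h=(h_s)$. $$K_1=\Big\{(f,x,q,d): f_k^{rs}\ge0,\ \sum_{k\in R_{rs}}f_k^{rs}=q_{rs},\ \sum_{s\in D}q_{rs}=O_r,\ \sum_{r\in O}\sum_{s\in D}\sum_{k\in R_{rs}}\delta_{ak}^{rs}f_k^{rs}=x_a,\ \sum_{r\in O}q_{rs}=d_s\ \ \forall k\in R_{rs},r\in O,s\in D,a\in A\Big\},$$ $$K_2=\Big\{h: h_s\ge0\ \forall s\in D,\ \sum_{s\in D}h_s=T\Big\}.$$ Parameters: $\alpha,\beta,\gamma>0$ with $\alpha\ge\gamma$. Standing assumptions on functions of nonnegative real arguments: each link travel time $t_a(x_a)$ is convex, continuously differentiable and strictly increasing; each trip attraction function $A_s(d_s,h_s)$ is continuously differentiable, strictly decreasing and strictly concave in $d_s$, and strictly increasing in $h_s$; each business attraction function $B_s(d_s,h_s)$ is continuously differentiable, strictly increasing in $d_s$ and strictly decreasing in $h_s$. Convention: since the variational inequality contains logarithms evaluated at the candidate solution, a solution is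 understood to have all components $f_k^{rs*},q_{rs}^*,h_s^*>0$. *)

theory Defs
  imports "HOL-Analysis.Analysis" "Graph_Theory.Arc_Walk"
begin

text \<open>Derivatives are taken within \<open>S\<close>, hence one-sided at boundary points: nothing is
  assumed about the values of the functions outside \<open>S\<close>.\<close>

definition continuously_differentiable_on ::
    "('a::real_normed_vector \<Rightarrow> 'b::real_normed_vector) \<Rightarrow> 'a set \<Rightarrow> bool"
  where "continuously_differentiable_on F S \<longleftrightarrow>
    (\<exists>F' :: 'a \<Rightarrow> 'a \<Rightarrow>\<^sub>L 'b.
       (\<forall>z\<in>S. (F has_derivative blinfun_apply (F' z)) (at z within S)) \<and> continuous_on S F')"

definition partial_1 :: "(real \<Rightarrow> real \<Rightarrow> real) \<Rightarrow> real \<Rightarrow> real \<Rightarrow> real"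
  where "partial_1 F u v = vector_derivative (\<lambda>w. F w v) (at u within {0..})"

definition partial_2 :: "(real \<Rightarrow> real \<Rightarrow> real) \<Rightarrow> real \<Rightarrow> real \<Rightarrow> real"
  where "partial_2 F u v = vector_derivative (\<lambda>w. F u w) (at v within {0..})"

definition strictly_concave_on :: "'a::real_vector set \<Rightarrow> ('a \<Rightarrow> real) \<Rightarrow> bool"
  where "strictly_concave_on S F \<longleftrightarrow> convex S \<and>
    (\<forall>y\<in>S. \<forall>z\<in>S. \<forall>\<theta>. y \<noteq> z \<and> 0 < \<theta> \<and> \<theta> < 1 \<longrightarrow>
       (1 - \<theta>) * F y + \<theta> * F z < F ((1 - \<theta>) *\<^sub>R y + \<theta> *\<^sub>R z))"

text \<open>A simple route is a directed path without repeated nodes, given by its list of links, so that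
  parallel links yield different routes.\<close>

definition routes :: "('v, 'e) pre_digraph \<Rightarrow> 'v \<Rightarrow> 'v \<Rightarrow> 'e list set"
  where "routes G r s = {k. pre_digraph.apath G r k s}"

definition link_route_incidence :: "'e \<Rightarrow> 'e list \<Rightarrow> real"
  where "link_route_incidence a k = of_bool (a \<in> set k)"

text \<open>A vector indexed by a finite set \<open>I\<close> is a function in \<open>extensional I\<close>; fixing the function
  outside \<open>I\<close> makes equality of functions coincide with equality of vectors.\<close>

definition route_indices ::
    "('v, 'e) pre_digraph \<Rightarrow> 'v set \<Rightarrow> 'v set \<Rightarrow> ('v \<times> 'v \<times> 'e list) set"
  where "route_indices G Orig Dest = {(r, s, k). r \<in> Orig \<and> s \<in> Dest \<and> k \<in> routes G r s}"

definition K1 ::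
    "('v, 'e) pre_digraph \<Rightarrow> 'v set \<Rightarrow> 'v set \<Rightarrow> ('v \<Rightarrow> real) \<Rightarrow>
     (('v \<times> 'v \<times> 'e list \<Rightarrow> real) \<times> ('e \<Rightarrow> real) \<times> ('v \<times> 'v \<Rightarrow> real) \<times> ('v \<Rightarrow> real)) set"
  where "K1 G Orig Dest demand = {(f, x, q, d).
    f \<in> extensional (route_indices G Orig Dest) \<and> x \<in> extensional (arcs G) \<and>
    q \<in> extensional (Orig \<times> Dest) \<and> d \<in> extensional Dest \<and>
    (\<forall>r\<in>Orig. \<forall>s\<in>Dest. \<forall>k\<in>routes G r s. 0 \<le> f (r, s, k)) \<and>
    (\<forall>r\<in>Orig. \<forall>s\<in>Dest. (\<Sum>k\<in>routes G r s. f (r, s, k)) = q (r, s)) \<and>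
    (\<forall>r\<in>Orig. (\<Sum>s\<in>Dest. q (r, s)) = demand r) \<and>
    (\<forall>a\<in>arcs G. (\<Sum>r\<in>Orig. \<Sum>s\<in>Dest. \<Sum>k\<in>routes G r s.
        link_route_incidence a k * f (r, s, k)) = x a) \<and>
    (\<forall>s\<in>Dest. (\<Sum>r\<in>Orig. q (r, s)) = d s)}"

definition K2 :: "'v set \<Rightarrow> real \<Rightarrow> ('v \<Rightarrow> real) set"
  where "K2 Dest T = {h. h \<in> extensional Dest \<and> (\<forall>s\<in>Dest. 0 \<le> h s) \<and> (\<Sum>s\<in>Dest. h s) = T}"

text \<open>The inequality evaluates logarithms at the candidate solution, so the components occurring
  under a logarithm are required to be positive; this is needed because \<open>ln 0 = 0\<close> in the library.\<close>

definition VI_solution ::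
    "('v, 'e) pre_digraph \<Rightarrow> 'v set \<Rightarrow> 'v set \<Rightarrow> ('v \<Rightarrow> real) \<Rightarrow> real \<Rightarrow>
     real \<Rightarrow> real \<Rightarrow> real \<Rightarrow> ('e \<Rightarrow> real \<Rightarrow> real) \<Rightarrow> ('v \<Rightarrow> real \<Rightarrow> real \<Rightarrow> real) \<Rightarrow>
     ('v \<Rightarrow> real \<Rightarrow> real \<Rightarrow> real) \<Rightarrow>
     (('v \<times> 'v \<times> 'e list \<Rightarrow> real) \<times> ('e \<Rightarrow> real) \<times> ('v \<times> 'v \<Rightarrow> real) \<times> ('v \<Rightarrow> real)) \<times>
       ('v \<Rightarrow> real) \<Rightarrow> bool"
  where "VI_solution G Orig Dest demand T \<alpha> \<beta> \<gamma> t A B = (\<lambda>((f', x', q', d'), h').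
    ((f', x', q', d'), h') \<in> K1 G Orig Dest demand \<times> K2 Dest T \<and>
    (\<forall>r\<in>Orig. \<forall>s\<in>Dest. \<forall>k\<in>routes G r s. 0 < f' (r, s, k)) \<and>
    (\<forall>r\<in>Orig. \<forall>s\<in>Dest. 0 < q' (r, s)) \<and>
    (\<forall>s\<in>Dest. 0 < h' s) \<and>
    (\<forall>((f, x, q, d), h) \<in> K1 G Orig Dest demand \<times> K2 Dest T.
       (\<Sum>r\<in>Orig. \<Sum>s\<in>Dest. \<Sum>k\<in>routes G r s.
            (f (r, s, k) - f' (r, s, k)) * (1 / \<alpha> * ln (f' (r, s, k))))
       + (\<Sum>a\<in>arcs G. (x a - x' a) * t a (x' a))
       + (\<Sum>r\<in>Orig. \<Sum>s\<in>Dest. (q (r, s) - q' (r, s)) * ((1 / \<gamma> - 1 / \<alpha>) * ln (q' (r, s))))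
       - (\<Sum>s\<in>Dest. (d s - d' s) * A s (d' s) (h' s))
       + (\<Sum>s\<in>Dest. (h s - h' s) * (1 / \<beta> * ln (h' s) - B s (d' s) (h' s)))
       \<ge> 0))"

end

theory Submission
  imports Defs
begin

text \<open>Eliminating \<open>x\<close>, \<open>q\<close> and \<open>d\<close>, which are linear images of \<open>f\<close>, turns \<open>K1 \<times> K2\<close> into a product of
  simplices: one for the path flows leaving each origin, and one for \<open>h\<close>.

  Existence. At a point with positive flows the variational inequality holds as soon as the marginal
  cost of a trip is the same for all routes leaving a given origin, and that of a business the same at
  all destinations
  (\<open>VI_solution_if_stationary\<close>). If the values of \<open>t\<close>, \<open>A\<close> and \<open>B\<close> are held fixed, these conditions have an
  explicit solution, a nested logit assignment: businesses and travellers choose destinations with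
  softmax shares, and the trips between two nodes spread over the routes with softmax shares. A solution is therefore
  a fixed point of the map that takes link flows, destination demands and business flows to those
  produced by the logit assignment. This map is continuous and sends a box into itself, so that
  Brouwer's theorem applies; its fixed points have positive flows automatically, and no argument
  at the boundary, where the logarithms are singular, is required.

  Uniqueness. Adding the inequalities of two solutions, each tested against the other one, leaves a
  sum of terms that are all nonpositive: the terms in \<open>f\<close>, \<open>q\<close> and \<open>h\<close> because the logarithm is
  increasing, the terms in \<open>x\<close> because travel times are increasing, and the terms in \<open>A\<close> and \<open>B\<close> because
  the two derivative conditions, together with the monotonicity of \<open>A\<close> in \<open>h\<close> and of \<open>B\<close> in \<open>d\<close>, make the
  symmetric part of the Jacobian of \<open>(A, B)\<close> negative definite. The logarithm is strictly increasing, hence \<open>f\<close> and \<open>h\<close> agree, and the rest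
  follows from \<open>f\<close>.

  The dimension of the box depends on the network and so is not the dimension of a type. Brouwer's
  theorem is therefore derived here for real functions on a finite index set (\<open>brouwer_box\<close>), starting
  from Kuhn's combinatorial lemma.\<close>

section \<open>Fixed points of continuous self-maps of boxes with a finite index set\<close>

lemma finite_family_convergent_subsequence:
  fixes X :: "nat \<Rightarrow> 'i \<Rightarrow> real"
  assumes "finite I" and "\<And>n i. i \<in> I \<Longrightarrow> X n i \<in> {a..b}"
  shows "\<exists>\<phi> l. strict_mono \<phi> \<and> (\<forall>i\<in>I. (\<lambda>n. X (\<phi> n) i) \<longlonglongrightarrow> l i)"
  using assms
proof (induction I rule: finite_induct)
  case empty
  show ?case by (auto intro: strict_mono_id)
next
  case (insert j I)
  then obtain \<phi> l where \<phi>: "strict_mono \<phi>" and l: "\<forall>i\<in>I. (\<lambda>n. X (\<phi> n) i) \<longlonglongrightarrow> l i"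
    by auto
  have "\<forall>n. X (\<phi> n) j \<in> {a..b}"
    using insert.prems by blast
  then obtain y \<psi> where \<psi>: "strict_mono \<psi>" and y: "((\<lambda>n. X (\<phi> n) j) \<circ> \<psi>) \<longlonglongrightarrow> y"
    using compact_Icc[of a b] unfolding compact_eq_seq_compact_metric seq_compact_def by meson
  have "(\<lambda>n. X ((\<phi> \<circ> \<psi>) n) i) \<longlonglongrightarrow> (l(j := y)) i" if "i \<in> insert j I" for i
    using that y LIMSEQ_subseq_LIMSEQ[OF bspec[OF l] \<psi>] by (auto simp: o_def)
  then show ?case
    using strict_mono_o[OF \<phi> \<psi>] by blast
qed

lemma tendsto_fun_iff:
  fixes X :: "'a \<Rightarrow> 'i \<Rightarrow> 'b::topological_space"
  shows "(X \<longlongrightarrow> x) F \<longleftrightarrow> (\<forall>i. ((\<lambda>n. X n i) \<longlongrightarrow> x i) F)"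
  using limitin_componentwise[of "\<lambda>_. euclidean" UNIV X x F]
  by (simp add: euclidean_product_topology)

text \<open>The combinatorial core of Brouwer's theorem. Grid points are labelled in every coordinate by the
  direction in which \<open>f\<close> moves them; Kuhn's lemma finds a cell of the grid that contains both labels for
  every coordinate.\<close>

lemma box_approximate_fixed_point:
  fixes f :: "('i \<Rightarrow> real) \<Rightarrow> 'i \<Rightarrow> real"
  assumes I: "finite I" and M: "0 < M" and p: "0 < (p::nat)"
    and f: "\<And>x i. x \<in> I \<rightarrow>\<^sub>E {0..M} \<Longrightarrow> i \<in> I \<Longrightarrow> f x i \<in> {0..M}"
  shows "\<exists>c \<in> I \<rightarrow>\<^sub>E {0..M}. \<forall>i\<in>I. \<exists>u \<in> I \<rightarrow>\<^sub>E {0..M}. \<exists>v \<in> I \<rightarrow>\<^sub>E {0..M}.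
           (\<forall>j\<in>I. \<bar>u j - c j\<bar> \<le> M / p \<and> \<bar>v j - c j\<bar> \<le> M / p) \<and> u i \<le> f u i \<and> f v i \<le> v i"
proof -
  obtain b where b: "bij_betw b {..<card I} I"
    using ex_bij_betw_nat_finite[OF I] by (auto simp: atLeast0LessThan)
  define g where "g = inv_into {..<card I} b"
  have g: "g j < card I" "b (g j) = j" if "j \<in> I" for j
    using that b by (auto simp: g_def bij_betw_def inv_into_into f_inv_into_f
        intro: inv_into_into[of j b "{..<card I}", simplified])
  have b_in: "b i \<in> I" "g (b i) = i" if "i < card I" for i
    using that b by (auto simp: g_def bij_betw_def)
  define pt where "pt y = (\<lambda>j\<in>I. M * real (y (g j)) / real p)" for y :: "nat \<Rightarrow> nat"
  have pt_in: "pt y \<in> I \<rightarrow>\<^sub>E {0..M}" if "\<forall>i<card I. y i \<le> p" for y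
    using that g(1) M p by (auto simp: pt_def field_simps)
  (* Label 0 means that f does not decrease the coordinate. The top face gets label 1 whatever
     f does there, as Kuhn's lemma demands; this is consistent because f maps into the box. *)
  define label where
    "label y i = (if y i < p \<and> pt y (b i) \<le> f (pt y) (b i) then 0 else 1 :: nat)" for y i
  have lab0: "pt y (b i) \<le> f (pt y) (b i)" if "label y i = 0" for y i
    using that by (auto simp: label_def split: if_splits)
  have lab1: "f (pt y) (b i) \<le> pt y (b i)"
    if "label y i \<noteq> 0" "\<forall>i<card I. y i \<le> p" "i < card I" for y i
  proof (cases "y i = p")
    case True
    then have "pt y (b i) = M"
      using b_in that p by (simp add: pt_def)
    then show ?thesis
      using f[OF pt_in[OF that(2)] b_in(1)[OF that(3)]] by simp
  next
    case False
    then have "y i < p"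
      using that by (simp add: le_neq_implies_less)
    then show ?thesis
      using that(1) by (auto simp: label_def split: if_splits)
  qed
  have lab_low: "label y i = 0" if "\<forall>i<card I. y i \<le> p" "i < card I" "y i = 0" for y i
    using f[OF pt_in[OF that(1)] b_in(1)[OF that(2)]] b_in that p
    by (simp add: label_def pt_def)
  have lab_high: "label y i = 1" if "y i = p" for y i
    using that by (simp add: label_def)
  obtain q where q: "\<forall>i<card I. q i < p"
    and cell: "\<forall>i<card I. \<exists>r s. (\<forall>j<card I. q j \<le> r j \<and> r j \<le> q j + 1) \<and>
      (\<forall>j<card I. q j \<le> s j \<and> s j \<le> q j + 1) \<and> label r i \<noteq> label s i"
    by (rule kuhn_lemma[of p "card I" label])
      (use p lab_low lab_high in \<open>auto simp: label_def\<close>)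
  have near: "\<bar>pt r j - pt q j\<bar> \<le> M / p"
    if "\<forall>j<card I. q j \<le> r j \<and> r j \<le> q j + 1" "j \<in> I" for r j
  proof -
    have "pt r j - pt q j = M / p * (real (r (g j)) - real (q (g j)))"
      using that p by (simp add: pt_def field_simps)
    moreover have "0 \<le> real (r (g j)) - real (q (g j))" "real (r (g j)) - real (q (g j)) \<le> 1"
      using that g(1)[of j] by (auto simp: le_diff_eq diff_le_eq)
    ultimately show ?thesis
      using M p mult_left_le[of "real (r (g j)) - real (q (g j))" "M / p"] by (simp add: abs_mult)
  qed
  show ?thesis
  proof (rule bexI[of _ "pt q"], rule ballI)
    fix i assume i: "i \<in> I"
    have le: "\<forall>j<card I. r j \<le> p" if "\<forall>j<card I. q j \<le> r j \<and> r j \<le> q j + 1" for r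
      using q that by (metis Suc_eq_plus1 Suc_leI le_trans)
    have witness: "\<exists>u \<in> I \<rightarrow>\<^sub>E {0..M}. \<exists>v \<in> I \<rightarrow>\<^sub>E {0..M}.
        (\<forall>j\<in>I. \<bar>u j - pt q j\<bar> \<le> M / p \<and> \<bar>v j - pt q j\<bar> \<le> M / p) \<and> u i \<le> f u i \<and> f v i \<le> v i"
      if r: "\<forall>j<card I. q j \<le> r j \<and> r j \<le> q j + 1" and s: "\<forall>j<card I. q j \<le> s j \<and> s j \<le> q j + 1"
        and rs: "label r (g i) = 0" "label s (g i) \<noteq> 0" for r s
    proof (rule bexI[OF _ pt_in[OF le[OF r]]], rule bexI[OF _ pt_in[OF le[OF s]]], intro conjI ballI)
      show "pt r i \<le> f (pt r) i" "f (pt s) i \<le> pt s i"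
        using lab0[OF rs(1)] lab1[OF rs(2) le[OF s] g(1)[OF i]] by (simp_all only: g(2)[OF i])
    qed (use near[OF r] near[OF s] in auto)
    obtain r s where rs: "\<forall>j<card I. q j \<le> r j \<and> r j \<le> q j + 1"
      "\<forall>j<card I. q j \<le> s j \<and> s j \<le> q j + 1" "label r (g i) \<noteq> label s (g i)"
      using cell g(1)[OF i] by blast
    show "\<exists>u \<in> I \<rightarrow>\<^sub>E {0..M}. \<exists>v \<in> I \<rightarrow>\<^sub>E {0..M}.
        (\<forall>j\<in>I. \<bar>u j - pt q j\<bar> \<le> M / p \<and> \<bar>v j - pt q j\<bar> \<le> M / p) \<and> u i \<le> f u i \<and> f v i \<le> v i"
    proof (cases "label r (g i) = 0")
      case True
      with rs(3) show ?thesis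
        by (intro witness[OF rs(1,2)]) auto
    next
      case False
      with rs(3) show ?thesis
        by (intro witness[OF rs(2,1)]) (auto simp: label_def split: if_splits)
    qed
  next
    show "pt q \<in> I \<rightarrow>\<^sub>E {0..M}"
      using q by (intro pt_in) (auto intro: less_imp_le)
  qed
qed

text \<open>The cells of finer and finer grids accumulate at a point \<open>x\<close>. In each coordinate \<open>i\<close> the two
  sequences of witnesses \<open>u\<close> and \<open>v\<close> both tend to \<open>x\<close>, and passing to the limit in \<open>u i \<le> f u i\<close> and
  \<open>f v i \<le> v i\<close> leaves \<open>f x i = x i\<close>.\<close>

lemma brouwer_box:
  fixes f :: "('i \<Rightarrow> real) \<Rightarrow> 'i \<Rightarrow> real"
  assumes I: "finite I" and M: "0 < M"
    and cont: "\<And>i. i \<in> I \<Longrightarrow> continuous_on (I \<rightarrow>\<^sub>E {0..M}) (\<lambda>x. f x i)"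
    and f: "\<And>x i. x \<in> I \<rightarrow>\<^sub>E {0..M} \<Longrightarrow> i \<in> I \<Longrightarrow> f x i \<in> {0..M}"
  shows "\<exists>x \<in> I \<rightarrow>\<^sub>E {0..M}. \<forall>i\<in>I. f x i = x i"
proof -
  let ?C = "I \<rightarrow>\<^sub>E {0..M}"
  define good where "good n c i u v \<longleftrightarrow> u \<in> ?C \<and> v \<in> ?C \<and>
      (\<forall>j\<in>I. \<bar>u j - c j\<bar> \<le> M / real (Suc n) \<and> \<bar>v j - c j\<bar> \<le> M / real (Suc n)) \<and>
      u i \<le> f u i \<and> f v i \<le> v i" for n c i u v
  have "\<exists>c\<in>?C. \<forall>i\<in>I. \<exists>u v. good n c i u v" for n
  proof -
    have "\<exists>c\<in>?C. \<forall>i\<in>I. \<exists>u\<in>?C. \<exists>v\<in>?C.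
        (\<forall>j\<in>I. \<bar>u j - c j\<bar> \<le> M / real (Suc n) \<and> \<bar>v j - c j\<bar> \<le> M / real (Suc n)) \<and>
        u i \<le> f u i \<and> f v i \<le> v i"
      by (rule box_approximate_fixed_point[OF I M zero_less_Suc f])
    then obtain c where "c \<in> ?C" and c: "\<forall>i\<in>I. \<exists>u\<in>?C. \<exists>v\<in>?C.
        (\<forall>j\<in>I. \<bar>u j - c j\<bar> \<le> M / real (Suc n) \<and> \<bar>v j - c j\<bar> \<le> M / real (Suc n)) \<and>
        u i \<le> f u i \<and> f v i \<le> v i" ..
    moreover have "\<exists>u v. good n c i u v" if "i \<in> I" for i
      using bspec[OF c that] unfolding good_def by blast
    ultimately show ?thesis
      by blast
  qed
  then obtain c where c: "\<And>n. c n \<in> ?C" and ex: "\<And>n i. i \<in> I \<Longrightarrow> \<exists>u v. good n (c n) i u v"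
    by metis
  have "\<forall>n i. \<exists>w. i \<in> I \<longrightarrow> good n (c n) i (fst w) (snd w)"
    using ex by (metis fst_conv snd_conv)
  then obtain w where w: "\<And>n i. i \<in> I \<Longrightarrow> good n (c n) i (fst (w n i)) (snd (w n i))"
    by metis
  define u v where "u n i = fst (w n i)" and "v n i = snd (w n i)" for n i
  have good: "good n (c n) i (u n i) (v n i)" if "i \<in> I" for n i
    using w[OF that] by (simp add: u_def v_def)
  have uC: "u n i \<in> ?C" and vC: "v n i \<in> ?C"
    and up: "u n i i \<le> f (u n i) i" and down: "f (v n i) i \<le> v n i i" if "i \<in> I" for n i
    using good[OF that] by (auto simp only: good_def)
  have u: "\<bar>u n i j - c n j\<bar> \<le> M / real (Suc n)" and v: "\<bar>v n i j - c n j\<bar> \<le> M / real (Suc n)"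
    if "i \<in> I" "j \<in> I" for n i j
    using good[OF that(1)] that(2) by (auto simp only: good_def)
  have cI: "c n i \<in> {0..M}" if "i \<in> I" for n i
    using c[of n] that by (auto simp: PiE_def Pi_def)
  obtain \<phi> l where \<phi>: "strict_mono \<phi>" and l: "\<forall>i\<in>I. (\<lambda>n. c (\<phi> n) i) \<longlonglongrightarrow> l i"
    using finite_family_convergent_subsequence[of I c 0 M, OF I cI] by blast
  define x where "x = restrict l I"
  have "x \<in> ?C"
  proof -
    have "l i \<in> {0..M}" if "i \<in> I" for i
      using Lim_in_closed_set[OF closed_real_atLeastAtMost _ _ bspec[OF l that], of 0 M] cI[OF that]
      by (simp del: atLeastAtMost_iff)
    then show ?thesis
      by (auto simp: x_def)
  qed
  have "(\<lambda>n. M / real (Suc n)) \<longlonglongrightarrow> 0"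
    by (rule LIMSEQ_Suc[OF lim_const_over_n])
  from LIMSEQ_subseq_LIMSEQ[OF this \<phi>]
  have mesh: "(\<lambda>n. M / real (Suc (\<phi> n))) \<longlonglongrightarrow> 0"
    by (simp add: o_def)
  have lim: "(\<lambda>n. w (\<phi> n)) \<longlonglongrightarrow> x"
    if wC: "\<And>n. w n \<in> ?C" and w: "\<And>n j. j \<in> I \<Longrightarrow> \<bar>w n j - c n j\<bar> \<le> M / real (Suc n)"
    for w :: "nat \<Rightarrow> 'i \<Rightarrow> real"
    unfolding tendsto_fun_iff
  proof
    fix j
    show "(\<lambda>n. w (\<phi> n) j) \<longlonglongrightarrow> x j"
    proof (cases "j \<in> I")
      case True
      have "(\<lambda>n. w (\<phi> n) j - c (\<phi> n) j) \<longlonglongrightarrow> 0"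
        by (rule tendsto_0_le[OF mesh, of _ 1]) (use w[OF True] M in auto)
      from tendsto_add[OF this bspec[OF l True]] show ?thesis
        using True by (simp add: x_def)
    next
      case False
      then have "w n j = undefined" for n
        using wC[of n] by (auto simp: PiE_def extensional_def)
      then show ?thesis
        using False by (simp add: x_def)
    qed
  qed
  have "f x i = x i" if i: "i \<in> I" for i
  proof (rule antisym)
    have lim_u: "(\<lambda>n. u (\<phi> n) i) \<longlonglongrightarrow> x" and lim_v: "(\<lambda>n. v (\<phi> n) i) \<longlonglongrightarrow> x"
      using lim[of "\<lambda>n. u n i"] lim[of "\<lambda>n. v n i"] uC vC u v i by auto
    have "(\<lambda>n. f (u (\<phi> n) i) i) \<longlonglongrightarrow> f x i" "(\<lambda>n. f (v (\<phi> n) i) i) \<longlonglongrightarrow> f x i"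
      using continuous_on_tendsto_compose[OF cont[OF i] lim_u \<open>x \<in> ?C\<close>]
        continuous_on_tendsto_compose[OF cont[OF i] lim_v \<open>x \<in> ?C\<close>] uC vC i by auto
    moreover have "(\<lambda>n. u (\<phi> n) i i) \<longlonglongrightarrow> x i" "(\<lambda>n. v (\<phi> n) i i) \<longlonglongrightarrow> x i"
      using lim_u lim_v by (auto simp: tendsto_fun_iff)
    ultimately show "x i \<le> f x i" "f x i \<le> x i"
      using up down i by (auto intro: LIMSEQ_le)
  qed
  with \<open>x \<in> ?C\<close> show ?thesis
    by blast
qed

section \<open>Partial derivatives on the closed quadrant\<close>

lemma at_within_nonneg_reals_nontrivial:
  fixes w :: real
  assumes "0 \<le> w" shows "at w within {0..} \<noteq> bot"
proof -
  have "at_right w \<le> at w within {0..}"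
    using assms by (intro at_le) auto
  then show ?thesis
    using trivial_limit_at_right_real[of w] by (auto simp: bot_unique)
qed

text \<open>Even at a boundary point of the quadrant the derivative is determined by its values on the two
  axis directions, because both one-sided axes lie in the quadrant.\<close>

lemma has_derivative_partials:
  assumes F: "continuously_differentiable_on (\<lambda>(u, v). F u v) ({0..} \<times> {0..})"
    and uv: "0 \<le> u" "0 \<le> v"
  shows "((\<lambda>(u, v). F u v) has_derivative (\<lambda>(a, b). a * partial_1 F u v + b * partial_2 F u v))
           (at (u, v) within {0..} \<times> {0..})"
    and "((\<lambda>w. F w v) has_real_derivative partial_1 F u v) (at u within {0..})"
    and "((\<lambda>w. F u w) has_real_derivative partial_2 F u v) (at v within {0..})"
proof -
  from F uv obtain D where
    D: "((\<lambda>(u, v). F u v) has_derivative blinfun_apply D) (at (u, v) within {0..} \<times> {0..})"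
    unfolding continuously_differentiable_on_def by force
  note nontriv = at_within_nonneg_reals_nontrivial
  have axes: "((\<lambda>w. (w, v)) has_derivative (\<lambda>a. (a, 0))) (at u within {0..})"
    "((\<lambda>w. (u, w)) has_derivative (\<lambda>b. (0, b))) (at v within {0..})"
    by (auto intro!: derivative_eq_intros)
  have 1: "((\<lambda>w. F w v) has_derivative (\<lambda>a. blinfun_apply D (a, 0))) (at u within {0..})"
    using has_derivative_in_compose[OF axes(1) has_derivative_subset[OF D]] uv
    by (auto simp: image_subset_iff)
  have 2: "((\<lambda>w. F u w) has_derivative (\<lambda>b. blinfun_apply D (0, b))) (at v within {0..})"
    using has_derivative_in_compose[OF axes(2) has_derivative_subset[OF D]] uv
    by (auto simp: image_subset_iff)
  have D1: "blinfun_apply D (a, 0) = a * blinfun_apply D (1, 0)" for a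
    using blinfun.scaleR_right[of D a "(1, 0)"] by simp
  have D2: "blinfun_apply D (0, b) = b * blinfun_apply D (0, 1)" for b
    using blinfun.scaleR_right[of D b "(0, 1)"] by simp
  have v1: "((\<lambda>w. F w v) has_vector_derivative blinfun_apply D (1, 0)) (at u within {0..})"
    using 1 unfolding has_vector_derivative_def by (subst (asm) D1) simp
  have v2: "((\<lambda>w. F u w) has_vector_derivative blinfun_apply D (0, 1)) (at v within {0..})"
    using 2 unfolding has_vector_derivative_def by (subst (asm) D2) simp
  have p1: "partial_1 F u v = blinfun_apply D (1, 0)"
    unfolding partial_1_def by (rule vector_derivative_within[OF nontriv[OF uv(1)] v1])
  have p2: "partial_2 F u v = blinfun_apply D (0, 1)"
    unfolding partial_2_def by (rule vector_derivative_within[OF nontriv[OF uv(2)] v2])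
  show "((\<lambda>w. F w v) has_real_derivative partial_1 F u v) (at u within {0..})"
    using v1 p1 by (simp add: has_real_derivative_iff_has_vector_derivative)
  show "((\<lambda>w. F u w) has_real_derivative partial_2 F u v) (at v within {0..})"
    using v2 p2 by (simp add: has_real_derivative_iff_has_vector_derivative)
  have "blinfun_apply D = (\<lambda>(a, b). a * partial_1 F u v + b * partial_2 F u v)"
  proof
    fix z :: "real \<times> real"
    show "blinfun_apply D z = (case z of (a, b) \<Rightarrow> a * partial_1 F u v + b * partial_2 F u v)"
      using blinfun.add_right[of D "(fst z, 0)" "(0, snd z)"] D1[of "fst z"] D2[of "snd z"]
      by (cases z) (simp add: p1 p2)
  qed
  then show "((\<lambda>(u, v). F u v) has_derivative (\<lambda>(a, b). a * partial_1 F u v + b * partial_2 F u v))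
           (at (u, v) within {0..} \<times> {0..})"
    using D by simp
qed

lemma mono_has_derivative_nonneg:
  fixes g :: "real \<Rightarrow> real"
  assumes g: "mono_on {0..} g" and D: "(g has_real_derivative D) (at x within {0..})" and x: "0 \<le> x"
  shows "0 \<le> D"
proof (rule tendsto_lowerbound)
  show "((\<lambda>y. (g y - g x) / (y - x)) \<longlongrightarrow> D) (at x within {0..})"
    using D by (simp add: has_field_derivative_iff)
  show "\<forall>\<^sub>F y in at x within {0..}. 0 \<le> (g y - g x) / (y - x)"
    unfolding eventually_at_filter
  proof (rule always_eventually, intro allI impI)
    fix y assume y: "y \<noteq> x" "y \<in> {0..}"
    show "0 \<le> (g y - g x) / (y - x)"
    proof (cases "x \<le> y")
      case True
      then show ?thesis using mono_onD[OF g, of x y] x by simp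
    next
      case False
      then show ?thesis using mono_onD[OF g, of y x] x y by (intro divide_nonpos_nonpos) auto
    qed
  qed
  show "at x within {0..} \<noteq> bot"
    by (rule at_within_nonneg_reals_nontrivial[OF x])
qed

text \<open>The map \<open>(A, B)\<close> is antimonotone along the segment from \<open>(u0, v0)\<close> to \<open>(u1, v1)\<close>. With
  \<open>a = u1 - u0\<close> and \<open>b = v1 - v0\<close>, the derivative along the segment is the quadratic form
  \<open>a\<^sup>2 A\<^sub>u + a b (A\<^sub>v + B\<^sub>u) + b\<^sup>2 B\<^sub>v\<close>. The mixed coefficient is nonnegative by monotonicity, so
  \<open>a b \<le> (a\<^sup>2 + b\<^sup>2) / 2\<close> splits the mixed term evenly between the two diagonal ones; this is where the
  factors 1/2 in the conditions come from.\<close>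

lemma quadrant_pair_antimonotone:
  assumes A: "continuously_differentiable_on (\<lambda>(u, v). A u v) ({0..} \<times> {0..})"
    and B: "continuously_differentiable_on (\<lambda>(u, v). B u v) ({0..} \<times> {0..})"
    and A_mono: "\<And>u. 0 \<le> u \<Longrightarrow> mono_on {0..} (\<lambda>v. A u v)"
    and B_mono: "\<And>v. 0 \<le> v \<Longrightarrow> mono_on {0..} (\<lambda>u. B u v)"
    and nonneg: "0 \<le> u0" "0 \<le> v0" "0 \<le> u1" "0 \<le> v1"
    and dom1: "\<And>\<theta>. 0 \<le> \<theta> \<Longrightarrow> \<theta> \<le> 1 \<Longrightarrow>
      partial_1 A ((1 - \<theta>) * u0 + \<theta> * u1) ((1 - \<theta>) * v0 + \<theta> * v1)
      + 1 / 2 * partial_2 A ((1 - \<theta>) * u0 + \<theta> * u1) ((1 - \<theta>) * v0 + \<theta> * v1)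
      + 1 / 2 * partial_1 B ((1 - \<theta>) * u0 + \<theta> * u1) ((1 - \<theta>) * v0 + \<theta> * v1) \<le> 0"
    and dom2: "\<And>\<theta>. 0 \<le> \<theta> \<Longrightarrow> \<theta> \<le> 1 \<Longrightarrow>
      partial_2 B ((1 - \<theta>) * u0 + \<theta> * u1) ((1 - \<theta>) * v0 + \<theta> * v1)
      + 1 / 2 * partial_1 B ((1 - \<theta>) * u0 + \<theta> * u1) ((1 - \<theta>) * v0 + \<theta> * v1)
      + 1 / 2 * partial_2 A ((1 - \<theta>) * u0 + \<theta> * u1) ((1 - \<theta>) * v0 + \<theta> * v1) \<le> 0"
  shows "(u1 - u0) * (A u1 v1 - A u0 v0) + (v1 - v0) * (B u1 v1 - B u0 v0) \<le> 0"
proof -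
  define a where "a = u1 - u0"
  define b where "b = v1 - v0"
  define U where "U \<theta> = (1 - \<theta>) * u0 + \<theta> * u1" for \<theta> :: real
  define V where "V \<theta> = (1 - \<theta>) * v0 + \<theta> * v1" for \<theta> :: real
  define \<Phi> where "\<Phi> \<theta> = a * A (U \<theta>) (V \<theta>) + b * B (U \<theta>) (V \<theta>)" for \<theta>
  define \<Phi>' where "\<Phi>' \<theta> = a * (a * partial_1 A (U \<theta>) (V \<theta>) + b * partial_2 A (U \<theta>) (V \<theta>))
    + b * (a * partial_1 B (U \<theta>) (V \<theta>) + b * partial_2 B (U \<theta>) (V \<theta>))" for \<theta>
  have UV: "0 \<le> U \<theta>" "0 \<le> V \<theta>" if "0 \<le> \<theta>" "\<theta> \<le> 1" for \<theta>
    using that nonneg by (auto simp: U_def V_def)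
  have segment: "((\<lambda>\<theta>. (U \<theta>, V \<theta>)) has_derivative (\<lambda>w. (w * a, w * b))) (at \<theta> within {0..1})" for \<theta>
    unfolding U_def V_def a_def b_def by (auto intro!: derivative_eq_intros simp: algebra_simps)
  have chain: "((\<lambda>\<theta>. F (U \<theta>) (V \<theta>)) has_derivative
      (\<lambda>w. w * a * partial_1 F (U \<theta>) (V \<theta>) + w * b * partial_2 F (U \<theta>) (V \<theta>))) (at \<theta> within {0..1})"
    if "0 \<le> \<theta>" "\<theta> \<le> 1" "continuously_differentiable_on (\<lambda>(u, v). F u v) ({0..} \<times> {0..})" for F \<theta>
    using has_derivative_in_compose[OF segment has_derivative_subset[OF
          has_derivative_partials(1)[OF that(3) UV[OF that(1,2)]], of "(\<lambda>\<theta>. (U \<theta>, V \<theta>)) ` {0..1}"]]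
      UV by (auto simp: image_subset_iff)
  have "(\<Phi> has_derivative (\<lambda>w. w * \<Phi>' \<theta>)) (at \<theta> within {0..1})" if "0 \<le> \<theta>" "\<theta> \<le> 1" for \<theta>
    unfolding \<Phi>_def
    by (rule has_derivative_eq_rhs[OF has_derivative_add[OF
          has_derivative_mult_right[OF chain[OF that A]] has_derivative_mult_right[OF chain[OF that B]]]])
      (auto simp: \<Phi>'_def algebra_simps)
  then obtain \<theta> where \<theta>: "0 \<le> \<theta>" "\<theta> \<le> 1" and mvt: "\<Phi> 1 - \<Phi> 0 = \<Phi>' \<theta>"
    using mvt_very_simple[of 0 1 \<Phi> "\<lambda>\<theta> w. w * \<Phi>' \<theta>"] by auto
  define Ad Ah Bd Bh where "Ad = partial_1 A (U \<theta>) (V \<theta>)" and "Ah = partial_2 A (U \<theta>) (V \<theta>)"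
    and "Bd = partial_1 B (U \<theta>) (V \<theta>)" and "Bh = partial_2 B (U \<theta>) (V \<theta>)"
  have "0 \<le> Ah" "0 \<le> Bd"
    unfolding Ah_def Bd_def
    by (rule mono_has_derivative_nonneg[OF A_mono has_derivative_partials(3)[OF A]]
             mono_has_derivative_nonneg[OF B_mono has_derivative_partials(2)[OF B]]; use UV[OF \<theta>] in simp)+
  moreover have "a * b \<le> (a\<^sup>2 + b\<^sup>2) / 2"
    using sum_squares_bound[of a b] by simp
  ultimately have cross: "a * b * (Ah + Bd) \<le> (a\<^sup>2 + b\<^sup>2) / 2 * (Ah + Bd)"
    by (intro mult_right_mono) auto
  have "\<Phi>' \<theta> = a\<^sup>2 * Ad + a * b * (Ah + Bd) + b\<^sup>2 * Bh"
    by (simp add: \<Phi>'_def Ad_def Ah_def Bd_def Bh_def algebra_simps power2_eq_square)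
  also have "\<dots> \<le> a\<^sup>2 * Ad + (a\<^sup>2 + b\<^sup>2) / 2 * (Ah + Bd) + b\<^sup>2 * Bh"
    using cross by simp
  also have "\<dots> = a\<^sup>2 * (Ad + 1 / 2 * Ah + 1 / 2 * Bd) + b\<^sup>2 * (Bh + 1 / 2 * Bd + 1 / 2 * Ah)"
    by (simp add: field_simps)
  also have "\<dots> \<le> 0"
    using dom1[OF \<theta>] dom2[OF \<theta>] unfolding Ad_def Ah_def Bd_def Bh_def U_def V_def
    by (rule add_nonpos_nonpos[OF mult_nonneg_nonpos[OF zero_le_power2]
          mult_nonneg_nonpos[OF zero_le_power2]])
  finally show ?thesis
    using mvt by (simp add: \<Phi>_def U_def V_def a_def b_def algebra_simps)
qed

lemma continuously_differentiable_on_imp_continuous_on: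
  assumes "continuously_differentiable_on F S" shows "continuous_on S F"
proof -
  obtain F' where F': "\<And>z. z \<in> S \<Longrightarrow> (F has_derivative blinfun_apply (F' z)) (at z within S)"
    using assms unfolding continuously_differentiable_on_def by blast
  show ?thesis
    by (rule has_derivative_continuous_on[OF F'])
qed

section \<open>Feasible flows\<close>

locale demand_network =
  fixes G :: "('v, 'e) pre_digraph"
    and Orig Dest :: "'v set"
    and demand :: "'v \<Rightarrow> real"
  assumes network: "fin_digraph G"
    and origins: "Orig \<subseteq> verts G"
    and destinations: "Dest \<subseteq> verts G" "Dest \<noteq> {}"
    and connected: "\<And>r s. r \<in> Orig \<Longrightarrow> s \<in> Dest \<Longrightarrow> routes G r s \<noteq> {}"
    and demand_pos: "\<And>r. r \<in> Orig \<Longrightarrow> 0 < demand r"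
begin

lemma finite_network: "finite Orig" "finite Dest" "finite (arcs G)" "finite (routes G r s)"
proof -
  interpret fin_digraph G by (rule network)
  show "finite Orig" "finite Dest" "finite (arcs G)" "finite (routes G r s)"
    using origins destinations apaths_finite[of r s] by (auto simp: routes_def intro: finite_subset)
qed

lemma route_indices_Sigma:
  "route_indices G Orig Dest = (SIGMA r:Orig. SIGMA s:Dest. routes G r s)"
  by (auto simp: route_indices_def)

lemma finite_route_indices: "finite (route_indices G Orig Dest)"
  unfolding route_indices_Sigma by (intro finite_SigmaI finite_network)

lemma sum_route_indices:
  "(\<Sum>r\<in>Orig. \<Sum>s\<in>Dest. \<Sum>k\<in>routes G r s. F r s k)
    = (\<Sum>(r, s, k)\<in>route_indices G Orig Dest. F r s k)"
  unfolding route_indices_Sigma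
  by (simp add: sum.Sigma finite_network finite_SigmaI case_prod_unfold)

text \<open>A point of \<open>K1\<close> is determined by its path flows; this is the point with path flows \<open>f\<close>.\<close>

definition flow_state :: "('v \<times> 'v \<times> 'e list \<Rightarrow> real) \<Rightarrow>
    ('v \<times> 'v \<times> 'e list \<Rightarrow> real) \<times> ('e \<Rightarrow> real) \<times> ('v \<times> 'v \<Rightarrow> real) \<times> ('v \<Rightarrow> real)"
  where "flow_state f =
    (restrict f (route_indices G Orig Dest),
     (\<lambda>a\<in>arcs G. \<Sum>r\<in>Orig. \<Sum>s\<in>Dest. \<Sum>k\<in>routes G r s. link_route_incidence a k * f (r, s, k)),
     (\<lambda>rs\<in>Orig \<times> Dest. \<Sum>k\<in>routes G (fst rs) (snd rs). f (fst rs, snd rs, k)),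
     (\<lambda>s\<in>Dest. \<Sum>r\<in>Orig. \<Sum>k\<in>routes G r s. f (r, s, k)))"

lemma flow_state_in_K1:
  assumes "\<And>r s k. r \<in> Orig \<Longrightarrow> s \<in> Dest \<Longrightarrow> k \<in> routes G r s \<Longrightarrow> 0 \<le> f (r, s, k)"
    and "\<And>r. r \<in> Orig \<Longrightarrow> (\<Sum>s\<in>Dest. \<Sum>k\<in>routes G r s. f (r, s, k)) = demand r"
  shows "flow_state f \<in> K1 G Orig Dest demand"
  using assms by (simp add: flow_state_def K1_def route_indices_def)

lemma K1_nonneg:
  assumes "(f, x, q, d) \<in> K1 G Orig Dest demand"
  shows "\<And>a. a \<in> arcs G \<Longrightarrow> 0 \<le> x a"
    and "\<And>r s. r \<in> Orig \<Longrightarrow> s \<in> Dest \<Longrightarrow> 0 \<le> q (r, s)"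
    and "\<And>s. s \<in> Dest \<Longrightarrow> 0 \<le> d s"
proof -
  note K = assms[unfolded K1_def, simplified]
  show q: "0 \<le> q (r, s)" if "r \<in> Orig" "s \<in> Dest" for r s
    using K that by (metis (no_types, lifting) sum_nonneg)
  show "0 \<le> d s" if "s \<in> Dest" for s
    using K q that by (metis (no_types, lifting) sum_nonneg)
  show "0 \<le> x a" if "a \<in> arcs G" for a
  proof -
    have "0 \<le> (\<Sum>r\<in>Orig. \<Sum>s\<in>Dest. \<Sum>k\<in>routes G r s. link_route_incidence a k * f (r, s, k))"
      using K by (intro sum_nonneg mult_nonneg_nonneg) (auto simp: link_route_incidence_def)
    then show ?thesis
      using K that by simp
  qed
qed

lemma K1_le_total_demand:
  assumes "(f, x, q, d) \<in> K1 G Orig Dest demand"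
  shows "\<And>a. a \<in> arcs G \<Longrightarrow> x a \<le> sum demand Orig"
    and "\<And>s. s \<in> Dest \<Longrightarrow> d s \<le> sum demand Orig"
proof -
  note K = assms[unfolded K1_def, simplified]
  note nonneg = K1_nonneg[OF assms]
  show "x a \<le> sum demand Orig" if "a \<in> arcs G" for a
  proof -
    have "x a = (\<Sum>r\<in>Orig. \<Sum>s\<in>Dest. \<Sum>k\<in>routes G r s. link_route_incidence a k * f (r, s, k))"
      using K that by simp
    also have "\<dots> \<le> (\<Sum>r\<in>Orig. \<Sum>s\<in>Dest. \<Sum>k\<in>routes G r s. f (r, s, k))"
      using K by (intro sum_mono) (auto simp: link_route_incidence_def)
    also have "\<dots> = sum demand Orig"
      using K by simp
    finally show ?thesis .
  qed
  show "d s \<le> sum demand Orig" if "s \<in> Dest" for s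
  proof -
    have "d s \<le> (\<Sum>s\<in>Dest. d s)"
      using nonneg that by (intro member_le_sum finite_network) auto
    also have "\<dots> = (\<Sum>s\<in>Dest. \<Sum>r\<in>Orig. q (r, s))"
      using K by simp
    also have "\<dots> = (\<Sum>r\<in>Orig. \<Sum>s\<in>Dest. q (r, s))"
      by (rule sum.swap)
    also have "\<dots> = sum demand Orig"
      using K by simp
    finally show ?thesis .
  qed
qed

lemma K1_segment:
  assumes 0: "(f0, x0, q0, d0) \<in> K1 G Orig Dest demand"
    and 1: "(f1, x1, q1, d1) \<in> K1 G Orig Dest demand"
    and \<theta>: "0 \<le> \<theta>" "\<theta> \<le> 1"
  shows "\<exists>f x q d. (f, x, q, d) \<in> K1 G Orig Dest demand \<and>
           (\<forall>s\<in>Dest. d s = (1 - \<theta>) * d0 s + \<theta> * d1 s)"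
proof -
  note K0 = 0[unfolded K1_def, simplified] and K1 = 1[unfolded K1_def, simplified]
  define f where "f i = (1 - \<theta>) * f0 i + \<theta> * f1 i" for i
  have q: "(\<Sum>k\<in>routes G r s. f (r, s, k)) = (1 - \<theta>) * q0 (r, s) + \<theta> * q1 (r, s)"
    if "r \<in> Orig" "s \<in> Dest" for r s
    using K0 K1 that by (simp add: f_def sum.distrib flip: sum_distrib_left)
  have "flow_state f \<in> K1 G Orig Dest demand"
  proof (rule flow_state_in_K1)
    show "0 \<le> f (r, s, k)" if "r \<in> Orig" "s \<in> Dest" "k \<in> routes G r s" for r s k
      using K0 K1 \<theta> that by (simp add: f_def)
    show "(\<Sum>s\<in>Dest. \<Sum>k\<in>routes G r s. f (r, s, k)) = demand r" if "r \<in> Orig" for r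
      using K0 K1 that
      by (simp add: q sum.distrib flip: sum_distrib_left) (simp add: algebra_simps)
  qed
  moreover have "(\<Sum>r\<in>Orig. \<Sum>k\<in>routes G r s. f (r, s, k)) = (1 - \<theta>) * d0 s + \<theta> * d1 s"
    if "s \<in> Dest" for s
    using K0 K1 that by (simp add: q sum.distrib flip: sum_distrib_left)
  ultimately show ?thesis
    unfolding flow_state_def by fastforce
qed

lemma K2_segment:
  assumes "h0 \<in> K2 Dest T" "h1 \<in> K2 Dest T" "0 \<le> \<theta>" "\<theta> \<le> 1"
  shows "\<exists>h \<in> K2 Dest T. \<forall>s\<in>Dest. h s = (1 - \<theta>) * h0 s + \<theta> * h1 s"
proof (rule bexI[of _ "\<lambda>s\<in>Dest. (1 - \<theta>) * h0 s + \<theta> * h1 s"])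
  show "(\<lambda>s\<in>Dest. (1 - \<theta>) * h0 s + \<theta> * h1 s) \<in> K2 Dest T"
    using assms unfolding K2_def
    by (simp add: sum.distrib flip: sum_distrib_left) (simp add: algebra_simps)
qed simp

lemma K1_eq_flow_state:
  assumes "(f, x, q, d) \<in> K1 G Orig Dest demand"
  shows "(f, x, q, d) = flow_state f"
proof -
  note K = assms[unfolded K1_def, simplified]
  have "f = restrict f (route_indices G Orig Dest)"
    using K by (simp add: extensional_restrict)
  moreover have "x = (\<lambda>a\<in>arcs G. \<Sum>r\<in>Orig. \<Sum>s\<in>Dest. \<Sum>k\<in>routes G r s.
      link_route_incidence a k * f (r, s, k))"
    using K by (intro extensionalityI[of _ "arcs G"]) auto
  moreover have "q = (\<lambda>rs\<in>Orig \<times> Dest. \<Sum>k\<in>routes G (fst rs) (snd rs). f (fst rs, snd rs, k))"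
    using K by (intro extensionalityI[of _ "Orig \<times> Dest"]) auto
  moreover have "d = (\<lambda>s\<in>Dest. \<Sum>r\<in>Orig. \<Sum>k\<in>routes G r s. f (r, s, k))"
    using K by (intro extensionalityI[of _ Dest]) auto
  ultimately show ?thesis
    unfolding flow_state_def prod.inject by blast
qed

lemma K1_eqI:
  assumes 0: "(f0, x0, q0, d0) \<in> K1 G Orig Dest demand"
    and 1: "(f1, x1, q1, d1) \<in> K1 G Orig Dest demand"
    and f: "\<And>i. i \<in> route_indices G Orig Dest \<Longrightarrow> f0 i = f1 i"
  shows "(f0, x0, q0, d0) = (f1, x1, q1, d1)"
proof -
  have "f0 \<in> extensional (route_indices G Orig Dest)" "f1 \<in> extensional (route_indices G Orig Dest)"
    using 0 1 by (auto simp: K1_def)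
  then have "f0 = f1"
    using f by (rule extensionalityI)
  then show ?thesis
    using K1_eq_flow_state[OF 0] K1_eq_flow_state[OF 1] by (simp only:)
qed

end

section \<open>Uniqueness of the solution\<close>

lemma ln_diff_antimonotone:
  assumes "0 < a" "0 < (b::real)"
  shows "(b - a) * (ln a - ln b) \<le> 0" and "(b - a) * (ln a - ln b) = 0 \<Longrightarrow> a = b"
  using assms by (cases a b rule: linorder_cases; auto simp: mult_le_0_iff)+

lemma mono_on_diff_nonpos:
  fixes g :: "real \<Rightarrow> real"
  assumes "mono_on S g" "a \<in> S" "b \<in> S"
  shows "(b - a) * (g a - g b) \<le> 0"
  using mono_onD[OF assms] mono_onD[OF assms(1,3,2)]
  by (cases "a \<le> b") (auto simp: mult_le_0_iff)

lemma sum_nonpos_eq_0D: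
  fixes g :: "'i \<Rightarrow> real"
  assumes "finite S" "\<And>i. i \<in> S \<Longrightarrow> g i \<le> 0" "sum g S = 0" "i \<in> S"
  shows "g i = 0"
  using sum_nonneg_eq_0_iff[of S "\<lambda>i. - g i"] assms by (simp add: sum_negf)

context demand_network
begin

text \<open>Strict monotonicity of the variational inequality. Equality of \<open>f\<close> comes from the terms weighted by \<open>1 / \<alpha>\<close> and equality of \<open>h\<close> from those weighted by
  \<open>1 / \<beta>\<close>; the assumption \<open>\<gamma> \<le> \<alpha>\<close> gives the terms in \<open>q\<close> the right sign.\<close>

lemma VI_solution_unique:
  assumes params: "0 < \<alpha>" "0 < \<beta>" "0 < \<gamma>" "\<gamma> \<le> \<alpha>"
    and t_mono: "\<And>a. a \<in> arcs G \<Longrightarrow> mono_on {0..} (t a)"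
    and pair_antimono: "\<And>f0 x0 q0 d0 h0 f1 x1 q1 d1 h1 s.
      (f0, x0, q0, d0) \<in> K1 G Orig Dest demand \<Longrightarrow> h0 \<in> K2 Dest T \<Longrightarrow>
      (f1, x1, q1, d1) \<in> K1 G Orig Dest demand \<Longrightarrow> h1 \<in> K2 Dest T \<Longrightarrow> s \<in> Dest \<Longrightarrow>
      (d1 s - d0 s) * (A s (d1 s) (h1 s) - A s (d0 s) (h0 s))
      + (h1 s - h0 s) * (B s (d1 s) (h1 s) - B s (d0 s) (h0 s)) \<le> 0"
    and sol0: "VI_solution G Orig Dest demand T \<alpha> \<beta> \<gamma> t A B z0"
    and sol1: "VI_solution G Orig Dest demand T \<alpha> \<beta> \<gamma> t A B z1"
  shows "z0 = z1"
proof -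
  obtain f0 x0 q0 d0 h0 f1 x1 q1 d1 h1
    where z: "z0 = ((f0, x0, q0, d0), h0)" "z1 = ((f1, x1, q1, d1), h1)"
    by (metis surj_pair)
  note S0 = sol0[unfolded z VI_solution_def, simplified] and S1 = sol1[unfolded z VI_solution_def, simplified]
  have K: "(f0, x0, q0, d0) \<in> K1 G Orig Dest demand" "h0 \<in> K2 Dest T"
    "(f1, x1, q1, d1) \<in> K1 G Orig Dest demand" "h1 \<in> K2 Dest T"
    using S0 S1 by auto
  note vi0 = sol0[unfolded z VI_solution_def prod.case, THEN conjunct2, THEN conjunct2, THEN conjunct2, THEN conjunct2]
    and vi1 = sol1[unfolded z VI_solution_def prod.case, THEN conjunct2, THEN conjunct2, THEN conjunct2, THEN conjunct2]
  define Pf where "Pf = (\<Sum>(r, s, k)\<in>route_indices G Orig Dest.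
    (f1 (r, s, k) - f0 (r, s, k)) * (ln (f0 (r, s, k)) - ln (f1 (r, s, k))))"
  define Px where "Px = (\<Sum>a\<in>arcs G. (x1 a - x0 a) * (t a (x0 a) - t a (x1 a)))"
  define Pq where "Pq = (\<Sum>r\<in>Orig. \<Sum>s\<in>Dest.
    (q1 (r, s) - q0 (r, s)) * (ln (q0 (r, s)) - ln (q1 (r, s))))"
  define Pdh where "Pdh = (\<Sum>s\<in>Dest. (d1 s - d0 s) * (A s (d1 s) (h1 s) - A s (d0 s) (h0 s))
    + (h1 s - h0 s) * (B s (d1 s) (h1 s) - B s (d0 s) (h0 s)))"
  define Ph where "Ph = (\<Sum>s\<in>Dest. (h1 s - h0 s) * (ln (h0 s) - ln (h1 s)))"
  have pos: "0 < f0 i" "0 < f1 i" if "i \<in> route_indices G Orig Dest" for i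
    using that S0 S1 by (auto simp: route_indices_def)
  have nonpos: "Pf \<le> 0" "Px \<le> 0" "Pq \<le> 0" "Pdh \<le> 0" "Ph \<le> 0"
    unfolding Pf_def Px_def Pq_def Pdh_def Ph_def
    using pos S0 S1 K1_nonneg[OF K(1)] K1_nonneg[OF K(3)] pair_antimono[OF K]
    by (auto intro!: sum_nonpos ln_diff_antimonotone mono_on_diff_nonpos[OF t_mono])
  (* The sum of the inequality at z0 tested with z1 and the inequality at z1 tested with z0. *)
  have "0 \<le> 1 / \<alpha> * Pf + Px + (1 / \<gamma> - 1 / \<alpha>) * Pq + Pdh + 1 / \<beta> * Ph"
  proof -
    have "0 \<le>
        ((\<Sum>r\<in>Orig. \<Sum>s\<in>Dest. \<Sum>k\<in>routes G r s.
            (f1 (r, s, k) - f0 (r, s, k)) * (1 / \<alpha> * ln (f0 (r, s, k))))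
       + (\<Sum>a\<in>arcs G. (x1 a - x0 a) * t a (x0 a))
       + (\<Sum>r\<in>Orig. \<Sum>s\<in>Dest. (q1 (r, s) - q0 (r, s)) * ((1 / \<gamma> - 1 / \<alpha>) * ln (q0 (r, s))))
       - (\<Sum>s\<in>Dest. (d1 s - d0 s) * A s (d0 s) (h0 s))
       + (\<Sum>s\<in>Dest. (h1 s - h0 s) * (1 / \<beta> * ln (h0 s) - B s (d0 s) (h0 s))))
      + ((\<Sum>r\<in>Orig. \<Sum>s\<in>Dest. \<Sum>k\<in>routes G r s.
            (f0 (r, s, k) - f1 (r, s, k)) * (1 / \<alpha> * ln (f1 (r, s, k))))
       + (\<Sum>a\<in>arcs G. (x0 a - x1 a) * t a (x1 a))
       + (\<Sum>r\<in>Orig. \<Sum>s\<in>Dest. (q0 (r, s) - q1 (r, s)) * ((1 / \<gamma> - 1 / \<alpha>) * ln (q1 (r, s))))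
       - (\<Sum>s\<in>Dest. (d0 s - d1 s) * A s (d1 s) (h1 s))
       + (\<Sum>s\<in>Dest. (h0 s - h1 s) * (1 / \<beta> * ln (h1 s) - B s (d1 s) (h1 s))))"
      (is "0 \<le> (?f0 + ?x0 + ?q0 - ?d0 + ?h0) + (?f1 + ?x1 + ?q1 - ?d1 + ?h1)")
    proof (rule add_nonneg_nonneg)
      show "0 \<le> ?f0 + ?x0 + ?q0 - ?d0 + ?h0"
        using bspec[OF vi0 SigmaI[OF K(3,4)]] by (simp only: prod.case)
      show "0 \<le> ?f1 + ?x1 + ?q1 - ?d1 + ?h1"
        using bspec[OF vi1 SigmaI[OF K(1,2)]] by (simp only: prod.case)
    qed
    moreover have "?f0 + ?f1 = 1 / \<alpha> * Pf"
      unfolding Pf_def sum_route_indices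
      by (simp add: sum_distrib_left case_prod_unfold algebra_simps flip: sum.distrib)
    moreover have "?x0 + ?x1 = Px"
      unfolding Px_def by (simp add: algebra_simps flip: sum.distrib)
    moreover have "?q0 + ?q1 = (1 / \<gamma> - 1 / \<alpha>) * Pq"
      unfolding Pq_def by (simp add: sum_distrib_left algebra_simps flip: sum.distrib)
    moreover have "?h0 + ?h1 - ?d0 - ?d1 = Pdh + 1 / \<beta> * Ph"
      unfolding Pdh_def Ph_def sum_distrib_left sum.distrib[symmetric] sum_subtractf[symmetric]
      by (rule sum.cong[OF refl]) (simp add: algebra_simps diff_divide_distrib)
    ultimately show ?thesis
      by linarith
  qed
  moreover have "0 \<le> 1 / \<alpha>" "0 \<le> 1 / \<gamma> - 1 / \<alpha>" "0 \<le> 1 / \<beta>"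
    using params by (simp_all add: frac_le)
  then have "1 / \<alpha> * Pf \<le> 0" "(1 / \<gamma> - 1 / \<alpha>) * Pq \<le> 0" "1 / \<beta> * Ph \<le> 0"
    using nonpos by (blast intro: mult_nonneg_nonpos)+
  ultimately have "1 / \<alpha> * Pf = 0" "1 / \<beta> * Ph = 0"
    using nonpos by linarith+
  then have "Pf = 0" "Ph = 0"
    using params by auto
  have "f0 i = f1 i" if i: "i \<in> route_indices G Orig Dest" for i
  proof -
    have sum0: "(\<Sum>i\<in>route_indices G Orig Dest. (f1 i - f0 i) * (ln (f0 i) - ln (f1 i))) = 0"
      using \<open>Pf = 0\<close> by (simp add: Pf_def case_prod_unfold)
    have "(f1 i - f0 i) * (ln (f0 i) - ln (f1 i)) = 0"
      by (rule sum_nonpos_eq_0D[OF finite_route_indices _ sum0 i]) (intro ln_diff_antimonotone(1) pos)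
    then show ?thesis
      using ln_diff_antimonotone(2) pos[OF i] by blast
  qed
  moreover have "h0 s = h1 s" if s: "s \<in> Dest" for s
  proof -
    have "(h1 s - h0 s) * (ln (h0 s) - ln (h1 s)) = 0"
      using S0 S1
      by (intro sum_nonpos_eq_0D[OF finite_network(2) _ \<open>Ph = 0\<close>[unfolded Ph_def] s]
          ln_diff_antimonotone(1)) auto
    then show ?thesis
      using ln_diff_antimonotone(2)[of "h0 s" "h1 s"] S0 S1 s by blast
  qed
  then have "h0 = h1"
    using K(2,4) by (auto simp: K2_def intro: extensionalityI)
  ultimately show ?thesis
    using K1_eqI[OF K(1,3)] by (simp add: z)
qed

end

section \<open>Logit shares\<close>

definition logsumexp :: "'i set \<Rightarrow> ('i \<Rightarrow> real) \<Rightarrow> real"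
  where "logsumexp S e = ln (\<Sum>j\<in>S. exp (e j))"

definition softmax :: "'i set \<Rightarrow> ('i \<Rightarrow> real) \<Rightarrow> 'i \<Rightarrow> real"
  where "softmax S e i = exp (e i) / (\<Sum>j\<in>S. exp (e j))"

context
  fixes S :: "'i set"
  assumes S: "finite S" "S \<noteq> {}"
begin

lemma sum_exp_pos: "0 < (\<Sum>j\<in>S. exp (e j :: real))"
  using S by (intro sum_pos) auto

lemma softmax_pos: "0 < softmax S e i"
  using sum_exp_pos by (simp add: softmax_def)

lemma sum_softmax: "(\<Sum>i\<in>S. softmax S e i) = 1"
  using sum_exp_pos[of e] by (simp add: softmax_def flip: sum_divide_distrib)

lemma ln_softmax: "ln (softmax S e i) = e i - logsumexp S e"
  using sum_exp_pos[of e] by (simp add: softmax_def logsumexp_def ln_div)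

lemma continuous_on_logsumexp:
  assumes "\<And>j. j \<in> S \<Longrightarrow> continuous_on C (\<lambda>w. e w j)"
  shows "continuous_on C (\<lambda>w. logsumexp S (e w))"
proof -
  have "(\<Sum>j\<in>S. exp (e w j)) \<noteq> 0" for w
    using sum_exp_pos[of "e w"] by simp
  then show ?thesis
    unfolding logsumexp_def
    by (intro continuous_on_ln continuous_on_sum continuous_on_exp assms) auto
qed

lemma continuous_on_softmax:
  assumes "\<And>j. j \<in> S \<Longrightarrow> continuous_on C (\<lambda>w. e w j)" and "i \<in> S"
  shows "continuous_on C (\<lambda>w. softmax S (e w) i)"
proof -
  have "(\<Sum>j\<in>S. exp (e w j)) \<noteq> 0" for w
    using sum_exp_pos[of "e w"] by simp
  then show ?thesis
    unfolding softmax_def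
    by (intro continuous_on_divide continuous_on_sum continuous_on_exp assms) auto
qed

end

section \<open>Existence of a solution\<close>

context demand_network
begin

text \<open>Collecting everything that multiplies the flow change on a route gives the marginal cost of that
  route. If it depends on the origin only, the left-hand side of the variational inequality vanishes for
  every test point, since the total flow from each origin and the total business flow are fixed.\<close>

lemma VI_solution_if_stationary:
  assumes K: "(f', x', q', d') \<in> K1 G Orig Dest demand" "h' \<in> K2 Dest T"
    and f_pos: "\<And>r s k. r \<in> Orig \<Longrightarrow> s \<in> Dest \<Longrightarrow> k \<in> routes G r s \<Longrightarrow> 0 < f' (r, s, k)"
    and h_pos: "\<And>s. s \<in> Dest \<Longrightarrow> 0 < h' s"
    and route_cost: "\<And>r s k. r \<in> Orig \<Longrightarrow> s \<in> Dest \<Longrightarrow> k \<in> routes G r s \<Longrightarrow>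
      1 / \<alpha> * ln (f' (r, s, k)) + (\<Sum>a\<in>arcs G. link_route_incidence a k * t a (x' a))
      + (1 / \<gamma> - 1 / \<alpha>) * ln (q' (r, s)) - A s (d' s) (h' s) = \<nu> r"
    and business_cost: "\<And>s. s \<in> Dest \<Longrightarrow> 1 / \<beta> * ln (h' s) - B s (d' s) (h' s) = \<mu>"
  shows "VI_solution G Orig Dest demand T \<alpha> \<beta> \<gamma> t A B ((f', x', q', d'), h')"
proof -
  have q_pos: "0 < q' (r, s)" if "r \<in> Orig" "s \<in> Dest" for r s
  proof -
    have "0 < (\<Sum>k\<in>routes G r s. f' (r, s, k))"
      using that by (intro sum_pos finite_network connected f_pos)
    then show ?thesis
      using K(1) that by (simp add: K1_def)
  qed
  have "(\<Sum>r\<in>Orig. \<Sum>s\<in>Dest. \<Sum>k\<in>routes G r s.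
            (f (r, s, k) - f' (r, s, k)) * (1 / \<alpha> * ln (f' (r, s, k))))
       + (\<Sum>a\<in>arcs G. (x a - x' a) * t a (x' a))
       + (\<Sum>r\<in>Orig. \<Sum>s\<in>Dest. (q (r, s) - q' (r, s)) * ((1 / \<gamma> - 1 / \<alpha>) * ln (q' (r, s))))
       - (\<Sum>s\<in>Dest. (d s - d' s) * A s (d' s) (h' s))
       + (\<Sum>s\<in>Dest. (h s - h' s) * (1 / \<beta> * ln (h' s) - B s (d' s) (h' s))) = 0"
    (is "?f + ?x + ?q - ?d + ?h = 0")
    if z: "(f, x, q, d) \<in> K1 G Orig Dest demand" "h \<in> K2 Dest T" for f x q d h
  proof -
    note K0 = K(1)[unfolded K1_def, simplified] and Kz = z(1)[unfolded K1_def, simplified]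
    define \<Delta> where "\<Delta> r s k = f (r, s, k) - f' (r, s, k)" for r s k
    have dq: "q (r, s) - q' (r, s) = (\<Sum>k\<in>routes G r s. \<Delta> r s k)" if "r \<in> Orig" "s \<in> Dest" for r s
      using K0 Kz that by (simp add: \<Delta>_def sum_subtractf)
    have dx: "x a - x' a = (\<Sum>r\<in>Orig. \<Sum>s\<in>Dest. \<Sum>k\<in>routes G r s. link_route_incidence a k * \<Delta> r s k)"
      if "a \<in> arcs G" for a
      using K0 Kz that by (simp add: \<Delta>_def sum_subtractf right_diff_distrib)
    have dd: "d s - d' s = (\<Sum>r\<in>Orig. \<Sum>k\<in>routes G r s. \<Delta> r s k)" if "s \<in> Dest" for s
    proof -
      have "d s - d' s = (\<Sum>r\<in>Orig. q (r, s) - q' (r, s))"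
        using K0 Kz that by (simp add: sum_subtractf)
      then show ?thesis
        using that by (simp add: dq)
    qed
    (* Travel times, demand terms and attractions are rewritten as sums over routes, so that all
       terms can be collected route by route. *)
    have x: "?x = (\<Sum>r\<in>Orig. \<Sum>s\<in>Dest. \<Sum>k\<in>routes G r s.
        \<Delta> r s k * (\<Sum>a\<in>arcs G. link_route_incidence a k * t a (x' a)))"
    proof -
      have "?x = (\<Sum>a\<in>arcs G. \<Sum>i\<in>route_indices G Orig Dest.
          case i of (r, s, k) \<Rightarrow> \<Delta> r s k * (link_route_incidence a k * t a (x' a)))"
        by (rule sum.cong[OF refl])
          (simp add: dx sum_route_indices sum_distrib_left sum_distrib_right case_prod_unfold mult_ac)
      also have "\<dots> = (\<Sum>i\<in>route_indices G Orig Dest. \<Sum>a\<in>arcs G.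
          case i of (r, s, k) \<Rightarrow> \<Delta> r s k * (link_route_incidence a k * t a (x' a)))"
        by (rule sum.swap)
      finally show ?thesis
        by (simp add: sum_route_indices sum_distrib_left case_prod_unfold)
    qed
    have q: "?q = (\<Sum>r\<in>Orig. \<Sum>s\<in>Dest. \<Sum>k\<in>routes G r s.
        \<Delta> r s k * ((1 / \<gamma> - 1 / \<alpha>) * ln (q' (r, s))))"
      by (simp add: dq sum_distrib_right)
    have d: "?d = (\<Sum>r\<in>Orig. \<Sum>s\<in>Dest. \<Sum>k\<in>routes G r s. \<Delta> r s k * A s (d' s) (h' s))"
      by (subst sum.swap) (simp add: dd sum_distrib_right)
    have "?f + ?x + ?q - ?d = (\<Sum>r\<in>Orig. \<Sum>s\<in>Dest. \<Sum>k\<in>routes G r s.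
        \<Delta> r s k * (1 / \<alpha> * ln (f' (r, s, k)) + (\<Sum>a\<in>arcs G. link_route_incidence a k * t a (x' a))
          + (1 / \<gamma> - 1 / \<alpha>) * ln (q' (r, s)) - A s (d' s) (h' s)))"
      unfolding x q d \<Delta>_def[symmetric]
      unfolding sum.distrib[symmetric] sum_subtractf[symmetric] distrib_left right_diff_distrib ..
    also have "\<dots> = (\<Sum>r\<in>Orig. \<Sum>s\<in>Dest. \<Sum>k\<in>routes G r s. \<Delta> r s k * \<nu> r)"
      using route_cost by simp
    also have "\<dots> = (\<Sum>r\<in>Orig. (\<Sum>s\<in>Dest. q (r, s) - q' (r, s)) * \<nu> r)"
      by (simp add: dq sum_distrib_right)
    also have "\<dots> = 0"
      using K0 Kz by (simp add: sum_subtractf)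
    finally have "?f + ?x + ?q - ?d = 0" .
    moreover have "?h = (\<Sum>s\<in>Dest. h s - h' s) * \<mu>"
      using business_cost by (simp add: sum_distrib_right)
    then have "?h = 0"
      using K(2) z(2) by (simp add: sum_subtractf K2_def)
    ultimately show ?thesis
      by simp
  qed
  then show ?thesis
    unfolding VI_solution_def using K f_pos h_pos q_pos by auto
qed

text \<open>A fixed point of the nested logit map \<open>\<Phi>\<close> is a solution. The utility \<open>V\<close> of a destination is
  its attraction minus the expected minimal travel cost to it, scaled by \<open>\<gamma>\<close>; that cost is \<open>- W / \<alpha>\<close>, where
  \<open>W\<close> is the log-sum over the routes. This is the choice for which the terms \<open>(1 / \<gamma> - 1 / \<alpha>) ln q\<close> cancel in the marginal cost of a route.\<close>

lemma VI_solution_exists: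
  assumes T: "0 < T" and params: "0 < \<alpha>" "0 < \<beta>" "0 < \<gamma>"
    and t_cont: "\<And>a. a \<in> arcs G \<Longrightarrow> continuous_on {0..} (t a)"
    and A_cont: "\<And>s. s \<in> Dest \<Longrightarrow> continuous_on ({0..} \<times> {0..}) (\<lambda>(u, v). A s u v)"
    and B_cont: "\<And>s. s \<in> Dest \<Longrightarrow> continuous_on ({0..} \<times> {0..}) (\<lambda>(u, v). B s u v)"
  shows "\<exists>z. VI_solution G Orig Dest demand T \<alpha> \<beta> \<gamma> t A B z"
proof -
  (* Any common bound for link flows, destination demands and business flows. *)
  define M where "M = sum demand Orig + T"
  have demand_nonneg: "0 \<le> sum demand Orig"
    using demand_pos by (intro sum_nonneg) (auto intro: less_imp_le)
  then have M: "0 < M" "sum demand Orig \<le> M" "T \<le> M"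
    using T by (auto simp: M_def)
  (* A point of the box lists link flows, destination demands and business flows. It need not
     be feasible; only its image under the logit map is. *)
  define I :: "('e + 'v + 'v) set" where "I = arcs G <+> (Dest <+> Dest)"
  define C where "C = I \<rightarrow>\<^sub>E {0..M}"
  define x where "x w a = w (Inl a)" for w :: "'e + 'v + 'v \<Rightarrow> real" and a
  define d where "d w s = w (Inr (Inl s))" for w :: "'e + 'v + 'v \<Rightarrow> real" and s
  define h where "h w s = w (Inr (Inr s))" for w :: "'e + 'v + 'v \<Rightarrow> real" and s
  define cost where "cost w k = (\<Sum>a\<in>arcs G. link_route_incidence a k * t a (x w a))" for w k
  define W where "W w r s = logsumexp (routes G r s) (\<lambda>k. - \<alpha> * cost w k)" for w r s
  define V where "V w s r = \<gamma> * (A s (d w s) (h w s) + W w r s / \<alpha>)" for w s r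
  define q where "q w r s = demand r * softmax Dest (\<lambda>s. V w s r) s" for w r s
  define f where "f w = (\<lambda>(r, s, k). q w r s * softmax (routes G r s) (\<lambda>k. - \<alpha> * cost w k) k)" for w
  define b where "b w s = T * softmax Dest (\<lambda>s. \<beta> * B s (d w s) (h w s)) s" for w s
  define load where "load w a = (\<Sum>r\<in>Orig. \<Sum>s\<in>Dest. \<Sum>k\<in>routes G r s.
    link_route_incidence a k * f w (r, s, k))" for w a
  define \<Phi> where "\<Phi> w i = (case i of Inl a \<Rightarrow> load w a
    | Inr (Inl s) \<Rightarrow> \<Sum>r\<in>Orig. \<Sum>k\<in>routes G r s. f w (r, s, k)
    | Inr (Inr s) \<Rightarrow> b w s)" for w i
  note Dest = finite_network(2) destinations(2)
  have q_pos: "0 < q w r s" if "r \<in> Orig" for w r s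
    using demand_pos[OF that] softmax_pos[OF Dest] by (simp add: q_def)
  have f_pos: "0 < f w (r, s, k)" if "r \<in> Orig" "s \<in> Dest" for w r s k
    using q_pos[OF that(1)] softmax_pos[OF finite_network(4) connected[OF that]] by (simp add: f_def)
  have sum_f: "(\<Sum>k\<in>routes G r s. f w (r, s, k)) = q w r s" if "r \<in> Orig" "s \<in> Dest" for w r s
    using sum_softmax[OF finite_network(4) connected[OF that]] by (simp add: f_def flip: sum_distrib_left)
  have sum_q: "(\<Sum>s\<in>Dest. q w r s) = demand r" for w r
    using sum_softmax[OF Dest] by (simp add: q_def flip: sum_distrib_left)
  have state: "flow_state (f w) \<in> K1 G Orig Dest demand" for w
    by (rule flow_state_in_K1) (use f_pos in \<open>auto simp: sum_f sum_q intro: less_imp_le\<close>)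
  have b_pos: "0 < b w s" for w s
    using T softmax_pos[OF Dest] by (simp add: b_def)
  have sum_b: "(\<Sum>s\<in>Dest. b w s) = T" for w
    using sum_softmax[OF Dest] by (simp add: b_def flip: sum_distrib_left)
  have b_state: "restrict (b w) Dest \<in> K2 Dest T" for w
    using b_pos sum_b by (auto simp: K2_def intro: less_imp_le)
  have b_le: "b w s \<le> T" if "s \<in> Dest" for w s
    using member_le_sum[OF that, of "b w"] sum_b[of w] b_pos[of w] finite_network(2) by (auto intro: less_imp_le)
  have I_cases [consumes 1, case_names link visitors business]: thesis
    if "i \<in> I" "\<And>a. a \<in> arcs G \<Longrightarrow> i = Inl a \<Longrightarrow> thesis"
      "\<And>s. s \<in> Dest \<Longrightarrow> i = Inr (Inl s) \<Longrightarrow> thesis" "\<And>s. s \<in> Dest \<Longrightarrow> i = Inr (Inr s) \<Longrightarrow> thesis"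
    for i thesis
    using that by (auto simp: I_def)
  have \<Phi>_in: "\<Phi> w i \<in> {0..M}" if "i \<in> I" for w i
    using that
  proof (cases rule: I_cases)
    case (link a)
    then show ?thesis
      using K1_nonneg(1)[OF state[of w, unfolded flow_state_def], of a] M
        K1_le_total_demand(1)[OF state[of w, unfolded flow_state_def], of a]
      by (simp add: \<Phi>_def load_def)
  next
    case (visitors s)
    then show ?thesis
      using K1_nonneg(3)[OF state[of w, unfolded flow_state_def], of s] M
        K1_le_total_demand(2)[OF state[of w, unfolded flow_state_def], of s]
      by (simp add: \<Phi>_def)
  next
    case (business s)
    then show ?thesis
      using b_le[of s w] b_pos[of w s] M by (simp add: \<Phi>_def)
  qed
  have coord: "continuous_on C (\<lambda>w. w i)" for i
    by (rule continuous_on_subset[OF continuous_on_product_coordinates]) simp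
  have C_nonneg: "0 \<le> w i" if "w \<in> C" "i \<in> I" for w i
    using that by (auto simp: C_def PiE_def Pi_def)
  have pair_cont: "continuous_on C (\<lambda>w. F (d w s) (h w s))"
    if "continuous_on ({0..} \<times> {0..}) (\<lambda>(u, v). F u v)" "s \<in> Dest" for F :: "real \<Rightarrow> real \<Rightarrow> real" and s
  proof -
    have "continuous_on C (\<lambda>w. case (d w s, h w s) of (u, v) \<Rightarrow> F u v)"
      by (rule continuous_on_compose2[OF that(1)])
        (use C_nonneg that(2) in \<open>auto simp: d_def h_def I_def intro!: continuous_on_Pair coord\<close>)
    then show ?thesis by simp
  qed
  have cost_cont: "continuous_on C (\<lambda>w. cost w k)" for k
    unfolding cost_def
  proof (intro continuous_on_sum continuous_on_mult continuous_on_const)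
    fix a assume a: "a \<in> arcs G"
    show "continuous_on C (\<lambda>w. t a (x w a))"
      unfolding x_def
      by (rule continuous_on_compose2[OF t_cont[OF a] coord])
        (use C_nonneg a in \<open>auto simp: I_def\<close>)
  qed
  have V_cont: "continuous_on C (\<lambda>w. V w s r)" if "r \<in> Orig" "s \<in> Dest" for r s
    unfolding V_def W_def
    by (intro continuous_on_mult continuous_on_add continuous_on_divide continuous_on_const
        pair_cont[OF A_cont] continuous_on_logsumexp finite_network connected cost_cont that)
      (use params in auto)
  have f_cont: "continuous_on C (\<lambda>w. f w (r, s, k))" if "r \<in> Orig" "s \<in> Dest" "k \<in> routes G r s" for r s k
    unfolding f_def q_def prod.case
    by (intro continuous_on_mult continuous_on_const continuous_on_softmax finite_network
        connected destinations cost_cont V_cont that)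
  have b_cont: "continuous_on C (\<lambda>w. b w s)" if "s \<in> Dest" for s
    unfolding b_def
    by (intro continuous_on_mult continuous_on_const continuous_on_softmax finite_network
        destinations pair_cont[OF B_cont] that)
  have \<Phi>_cont: "continuous_on C (\<lambda>w. \<Phi> w i)" if "i \<in> I" for i
    using that
  proof (cases rule: I_cases)
    case (link a)
    then show ?thesis
      by (auto simp: \<Phi>_def load_def intro!: continuous_on_sum continuous_on_mult continuous_on_const f_cont)
  next
    case (visitors s)
    then show ?thesis
      by (auto simp: \<Phi>_def intro!: continuous_on_sum f_cont)
  next
    case (business s)
    then show ?thesis
      by (auto simp: \<Phi>_def intro!: b_cont)
  qed
  have "finite I"
    by (simp add: I_def finite_network)
  then have "\<exists>w \<in> I \<rightarrow>\<^sub>E {0..M}. \<forall>i\<in>I. \<Phi> w i = w i"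
    using M(1) \<Phi>_cont \<Phi>_in unfolding C_def by (intro brouwer_box)
  then obtain w where fixed: "\<And>i. i \<in> I \<Longrightarrow> \<Phi> w i = w i"
    by blast
  have in_I: "a \<in> arcs G \<Longrightarrow> Inl a \<in> I" "s \<in> Dest \<Longrightarrow> Inr (Inl s) \<in> I"
    "s \<in> Dest \<Longrightarrow> Inr (Inr s) \<in> I" for a s
    by (auto simp: I_def)
  have x: "x w a = load w a" if "a \<in> arcs G" for a
    using fixed[of "Inl a"] in_I(1)[OF that] by (simp add: \<Phi>_def x_def)
  have d: "d w s = (\<Sum>r\<in>Orig. \<Sum>k\<in>routes G r s. f w (r, s, k))" if "s \<in> Dest" for s
    using fixed[of "Inr (Inl s)"] in_I(2)[OF that] by (simp add: \<Phi>_def d_def)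
  have d_q: "(\<Sum>r\<in>Orig. q w r s) = d w s" if "s \<in> Dest" for s
    using d[OF that] that by (simp add: sum_f)
  have h: "h w s = b w s" if "s \<in> Dest" for s
    using fixed[of "Inr (Inr s)"] in_I(3)[OF that] by (simp add: \<Phi>_def h_def)
  have ln_q: "ln (q w r s) = ln (demand r) + V w s r - logsumexp Dest (\<lambda>s. V w s r)"
    if "r \<in> Orig" for r s
    using demand_pos[OF that] softmax_pos[OF Dest] by (simp add: q_def ln_mult_pos ln_softmax[OF Dest])
  have ln_f: "ln (f w (r, s, k)) = ln (q w r s) - \<alpha> * cost w k - W w r s"
    if "r \<in> Orig" "s \<in> Dest" for r s k
    using q_pos[OF that(1)] softmax_pos[OF finite_network(4) connected[OF that]]
    by (simp add: f_def W_def ln_mult_pos ln_softmax[OF finite_network(4) connected[OF that]])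
  have "VI_solution G Orig Dest demand T \<alpha> \<beta> \<gamma> t A B (flow_state (f w), restrict (b w) Dest)"
    unfolding flow_state_def
  proof (rule VI_solution_if_stationary[OF state[unfolded flow_state_def] b_state])
    fix r s k assume rsk: "r \<in> Orig" "s \<in> Dest" "k \<in> routes G r s"
    then have i: "(r, s, k) \<in> route_indices G Orig Dest"
      by (simp add: route_indices_def)
    show "0 < restrict (f w) (route_indices G Orig Dest) (r, s, k)"
      using f_pos rsk i by simp
    (* The marginal cost of a route: the right-hand side does not mention s and k. *)
    have "1 / \<alpha> * ln (f w (r, s, k)) + cost w k + (1 / \<gamma> - 1 / \<alpha>) * ln (q w r s)
        - A s (d w s) (h w s) = (ln (demand r) - logsumexp Dest (\<lambda>s. V w s r)) / \<gamma>"
    proof -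
      have "1 / \<alpha> * ln (f w (r, s, k)) + cost w k + (1 / \<gamma> - 1 / \<alpha>) * ln (q w r s)
        = ln (q w r s) / \<gamma> - W w r s / \<alpha>"
        using params unfolding ln_f[OF rsk(1,2)] by (simp add: field_simps)
      also have "\<dots> = (ln (demand r) - logsumexp Dest (\<lambda>s. V w s r)) / \<gamma> + A s (d w s) (h w s)"
        using params unfolding ln_q[OF rsk(1)] by (simp add: V_def[of w s r] diff_divide_distrib add_divide_distrib)
      finally show ?thesis by simp
    qed
    then show "1 / \<alpha> * ln (restrict (f w) (route_indices G Orig Dest) (r, s, k))
        + (\<Sum>a\<in>arcs G. link_route_incidence a k * t a ((\<lambda>a\<in>arcs G. \<Sum>r\<in>Orig. \<Sum>s\<in>Dest.
            \<Sum>k\<in>routes G r s. link_route_incidence a k * f w (r, s, k)) a))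
        + (1 / \<gamma> - 1 / \<alpha>) * ln ((\<lambda>rs\<in>Orig \<times> Dest. \<Sum>k\<in>routes G (fst rs) (snd rs).
            f w (fst rs, snd rs, k)) (r, s))
        - A s ((\<lambda>s\<in>Dest. \<Sum>r\<in>Orig. \<Sum>k\<in>routes G r s. f w (r, s, k)) s) (restrict (b w) Dest s)
      = (ln (demand r) - logsumexp Dest (\<lambda>s. V w s r)) / \<gamma>"
      using rsk i by (simp add: cost_def x load_def[symmetric] h sum_f d_q)
  next
    fix s assume s: "s \<in> Dest"
    show "0 < restrict (b w) Dest s"
      using b_pos s by simp
    have "ln (b w s) = ln T + \<beta> * B s (d w s) (h w s) - logsumexp Dest (\<lambda>s. \<beta> * B s (d w s) (h w s))"
      using T softmax_pos[OF Dest] by (simp add: b_def ln_mult_pos ln_softmax[OF Dest])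
    then have "1 / \<beta> * ln (b w s) - B s (d w s) (h w s)
        = (ln T - logsumexp Dest (\<lambda>s. \<beta> * B s (d w s) (h w s))) / \<beta>"
      using params by (simp add: field_simps)
    then show "1 / \<beta> * ln (restrict (b w) Dest s)
        - B s ((\<lambda>s\<in>Dest. \<Sum>r\<in>Orig. \<Sum>k\<in>routes G r s. f w (r, s, k)) s) (restrict (b w) Dest s)
      = (ln T - logsumexp Dest (\<lambda>s. \<beta> * B s (d w s) (h w s))) / \<beta>"
      using s by (simp add: h sum_f d_q)
  qed
  then show ?thesis
    by blast
qed

end

theorem theorem4:
  fixes G :: "('v, 'e) pre_digraph"
    and Orig Dest :: "'v set"
    and demand :: "'v \<Rightarrow> real"
    and T \<alpha> \<beta> \<gamma> :: real
    and t :: "'e \<Rightarrow> real \<Rightarrow> real"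
    and A B :: "'v \<Rightarrow> real \<Rightarrow> real \<Rightarrow> real"
  assumes network: "fin_digraph G"
    and origins: "Orig \<subseteq> verts G" "Orig \<noteq> {}"
    and destinations: "Dest \<subseteq> verts G" "Dest \<noteq> {}"
    and connected: "\<And>r s. r \<in> Orig \<Longrightarrow> s \<in> Dest \<Longrightarrow> routes G r s \<noteq> {}"
    and demand_pos: "\<And>r. r \<in> Orig \<Longrightarrow> 0 < demand r"
    and total_pos: "0 < T"
    and params: "0 < \<alpha>" "0 < \<beta>" "0 < \<gamma>" "\<gamma> \<le> \<alpha>"
    and t_convex: "\<And>a. a \<in> arcs G \<Longrightarrow> convex_on {0..} (t a)"
    and t_C1: "\<And>a. a \<in> arcs G \<Longrightarrow> continuously_differentiable_on (t a) {0..}"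
    and t_incr: "\<And>a. a \<in> arcs G \<Longrightarrow> strict_mono_on {0..} (t a)"
    and A_C1: "\<And>s. s \<in> Dest \<Longrightarrow>
      continuously_differentiable_on (\<lambda>(u, v). A s u v) ({0..} \<times> {0..})"
    and A_decr: "\<And>s v. s \<in> Dest \<Longrightarrow> 0 \<le> v \<Longrightarrow> strict_antimono_on {0..} (\<lambda>u. A s u v)"
    and A_concave: "\<And>s v. s \<in> Dest \<Longrightarrow> 0 \<le> v \<Longrightarrow> strictly_concave_on {0..} (\<lambda>u. A s u v)"
    and A_incr: "\<And>s u. s \<in> Dest \<Longrightarrow> 0 \<le> u \<Longrightarrow> strict_mono_on {0..} (\<lambda>v. A s u v)"
    and B_C1: "\<And>s. s \<in> Dest \<Longrightarrow>
      continuously_differentiable_on (\<lambda>(u, v). B s u v) ({0..} \<times> {0..})"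
    and B_incr: "\<And>s v. s \<in> Dest \<Longrightarrow> 0 \<le> v \<Longrightarrow> strict_mono_on {0..} (\<lambda>u. B s u v)"
    and B_decr: "\<And>s u. s \<in> Dest \<Longrightarrow> 0 \<le> u \<Longrightarrow> strict_antimono_on {0..} (\<lambda>v. B s u v)"
    and cond1: "\<forall>((f, x, q, d), h) \<in> K1 G Orig Dest demand \<times> K2 Dest T. \<forall>s\<in>Dest.
      partial_1 (A s) (d s) (h s) + 1 / 2 * partial_2 (A s) (d s) (h s)
        + 1 / 2 * partial_1 (B s) (d s) (h s) < 0"
    and cond2: "\<forall>((f, x, q, d), h) \<in> K1 G Orig Dest demand \<times> K2 Dest T. \<forall>s\<in>Dest.
      partial_2 (B s) (d s) (h s) + 1 / 2 * partial_1 (B s) (d s) (h s)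
        + 1 / 2 * partial_2 (A s) (d s) (h s) < 0"
  shows "\<exists>!z. VI_solution G Orig Dest demand T \<alpha> \<beta> \<gamma> t A B z"
proof -
  interpret demand_network G Orig Dest demand
    by (rule demand_network.intro) (use assms in auto)
  have t_cont: "continuous_on {0..} (t a)" if "a \<in> arcs G" for a
    using continuously_differentiable_on_imp_continuous_on[OF t_C1[OF that]] .
  have A_cont: "continuous_on ({0..} \<times> {0..}) (\<lambda>(u, v). A s u v)"
    and B_cont: "continuous_on ({0..} \<times> {0..}) (\<lambda>(u, v). B s u v)" if "s \<in> Dest" for s
    using continuously_differentiable_on_imp_continuous_on A_C1[OF that] B_C1[OF that] by blast+
  have pair: "(d1 s - d0 s) * (A s (d1 s) (h1 s) - A s (d0 s) (h0 s))
      + (h1 s - h0 s) * (B s (d1 s) (h1 s) - B s (d0 s) (h0 s)) \<le> 0"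
    if z0: "(f0, x0, q0, d0) \<in> K1 G Orig Dest demand" "h0 \<in> K2 Dest T"
      and z1: "(f1, x1, q1, d1) \<in> K1 G Orig Dest demand" "h1 \<in> K2 Dest T" and s: "s \<in> Dest"
    for f0 x0 q0 d0 h0 f1 x1 q1 d1 h1 s
  proof -
    have dominance: "partial_1 (A s) ((1 - \<theta>) * d0 s + \<theta> * d1 s) ((1 - \<theta>) * h0 s + \<theta> * h1 s)
        + 1 / 2 * partial_2 (A s) ((1 - \<theta>) * d0 s + \<theta> * d1 s) ((1 - \<theta>) * h0 s + \<theta> * h1 s)
        + 1 / 2 * partial_1 (B s) ((1 - \<theta>) * d0 s + \<theta> * d1 s) ((1 - \<theta>) * h0 s + \<theta> * h1 s) \<le> 0"
      "partial_2 (B s) ((1 - \<theta>) * d0 s + \<theta> * d1 s) ((1 - \<theta>) * h0 s + \<theta> * h1 s)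
        + 1 / 2 * partial_1 (B s) ((1 - \<theta>) * d0 s + \<theta> * d1 s) ((1 - \<theta>) * h0 s + \<theta> * h1 s)
        + 1 / 2 * partial_2 (A s) ((1 - \<theta>) * d0 s + \<theta> * d1 s) ((1 - \<theta>) * h0 s + \<theta> * h1 s) \<le> 0"
      if \<theta>: "0 \<le> \<theta>" "\<theta> \<le> 1" for \<theta>
    proof -
      (* The two conditions speak of feasible points, so the point of the segment between the two
         pairs has to be recognised as the pair of a feasible point. *)
      obtain f x q d where fxqd: "(f, x, q, d) \<in> K1 G Orig Dest demand"
        and d: "\<forall>s\<in>Dest. d s = (1 - \<theta>) * d0 s + \<theta> * d1 s"
        using K1_segment[OF z0(1) z1(1) \<theta>] by blast
      obtain h where h: "h \<in> K2 Dest T" "\<forall>s\<in>Dest. h s = (1 - \<theta>) * h0 s + \<theta> * h1 s"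
        using K2_segment[OF z0(2) z1(2) \<theta>] by blast
      have "\<forall>s\<in>Dest. partial_1 (A s) (d s) (h s) + 1 / 2 * partial_2 (A s) (d s) (h s)
          + 1 / 2 * partial_1 (B s) (d s) (h s) < 0"
        using bspec[OF cond1 SigmaI[OF fxqd h(1)]] by (simp only: prod.case)
      moreover have "\<forall>s\<in>Dest. partial_2 (B s) (d s) (h s) + 1 / 2 * partial_1 (B s) (d s) (h s)
          + 1 / 2 * partial_2 (A s) (d s) (h s) < 0"
        using bspec[OF cond2 SigmaI[OF fxqd h(1)]] by (simp only: prod.case)
      ultimately show
        "partial_1 (A s) ((1 - \<theta>) * d0 s + \<theta> * d1 s) ((1 - \<theta>) * h0 s + \<theta> * h1 s)
        + 1 / 2 * partial_2 (A s) ((1 - \<theta>) * d0 s + \<theta> * d1 s) ((1 - \<theta>) * h0 s + \<theta> * h1 s)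
        + 1 / 2 * partial_1 (B s) ((1 - \<theta>) * d0 s + \<theta> * d1 s) ((1 - \<theta>) * h0 s + \<theta> * h1 s) \<le> 0"
        "partial_2 (B s) ((1 - \<theta>) * d0 s + \<theta> * d1 s) ((1 - \<theta>) * h0 s + \<theta> * h1 s)
        + 1 / 2 * partial_1 (B s) ((1 - \<theta>) * d0 s + \<theta> * d1 s) ((1 - \<theta>) * h0 s + \<theta> * h1 s)
        + 1 / 2 * partial_2 (A s) ((1 - \<theta>) * d0 s + \<theta> * d1 s) ((1 - \<theta>) * h0 s + \<theta> * h1 s) \<le> 0"
        using d h(2) s by (metis less_imp_le)+
    qed
    have nonneg: "0 \<le> d0 s" "0 \<le> h0 s" "0 \<le> d1 s" "0 \<le> h1 s"
      using K1_nonneg(3)[OF z0(1) s] K1_nonneg(3)[OF z1(1) s] z0(2) z1(2) s by (auto simp: K2_def)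
    show ?thesis
      by (rule quadrant_pair_antimonotone[OF A_C1[OF s] B_C1[OF s]
            strict_mono_on_imp_mono_on[OF A_incr[OF s]] strict_mono_on_imp_mono_on[OF B_incr[OF s]]
            nonneg dominance])
  qed
  have "\<exists>z. VI_solution G Orig Dest demand T \<alpha> \<beta> \<gamma> t A B z"
    by (rule VI_solution_exists[OF total_pos params(1-3)]) (erule t_cont A_cont B_cont)+
  moreover have "z = z'"
    if "VI_solution G Orig Dest demand T \<alpha> \<beta> \<gamma> t A B z" "VI_solution G Orig Dest demand T \<alpha> \<beta> \<gamma> t A B z'"
    for z z'
    using that
    by (rule VI_solution_unique[OF params, rotated 2])
      (erule strict_mono_on_imp_mono_on[OF t_incr], rule pair)
  ultimately show ?thesis
    by blast
qed

end
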